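(* Let $A$ be a finite alphabet, let $M_A$ be the free inverse monoid on $A$, and let $\varphi$ be a monoid endomorphism of $M_A$ such that the restriction $\varphi|_{\widetilde{A}}$ is a permutation of $\widetilde{A}$ without fixed points. Then $\mathrm{Fix}(\varphi)=\{x\in M_A: x\varphi=x\}$ is not context-free.
   Context: Let $A^{-1}$ be a set of formal inverses of $A$, $\widetilde{A}=A\cup A^{-1}$, and extend $a\mapsto a^{-1}$ to an involution on the free monoid $\widetilde{A}^*$ by $1^{-1}=1$, $(a^{-1})^{-1}=a$, $(uv)^{-1}=v^{-1}u^{-1}$. The free inverse monoid $M_A$ is the quotient of $\widetilde{A}^*$ by the congruence generated by $\{(uu^{-1}u,u)\mid u\in\widetilde{A}^*\}\cup\{(uu^{-1}vv^{-1},vv^{-1}uu^{-1})\mid u,v\in\widetilde{A}^*\}$, and $\pi:\widetilde{A}^*\to M_A$ is the canonical homomorphism; letters of $\widetilde{A}$ are identified with their images in $M_A$. Maps are written on the right. A subset $X\subseteq M_A$ is called context-free if $X=L\pi$ for some context-free language $L\subseteq\widetilde{A}^*$. *)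

theory Defs
  imports Main
begin

text \<open>The alphabet is a type \<open>'a\<close>; \<open>'a letter\<close> is the doubled alphabet, the disjoint union
  of the alphabet and its set of formal inverses, and \<open>'a letter list\<close> (with append) is the
  free monoid on it.\<close>

datatype 'a letter = Pos 'a | Neg 'a

fun inv_letter :: "'a letter \<Rightarrow> 'a letter" where
  "inv_letter (Pos a) = Neg a"
| "inv_letter (Neg a) = Pos a"

definition inv_word :: "'a letter list \<Rightarrow> 'a letter list" where
  "inv_word u = rev (map inv_letter u)"

lemma inv_letter_inv_letter [simp]: "inv_letter (inv_letter x) = x"
  by (cases x) simp_all

lemma inv_word_Nil [simp]: "inv_word [] = []"
  by (simp add: inv_word_def)

lemma inv_word_append: "inv_word (u @ v) = inv_word v @ inv_word u"
  by (simp add: inv_word_def)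

lemma inv_word_inv_word [simp]: "inv_word (inv_word u) = u"
  by (simp add: inv_word_def rev_map comp_def)

inductive fim_cong :: "'a letter list \<Rightarrow> 'a letter list \<Rightarrow> bool" where
  regular: "fim_cong (u @ inv_word u @ u) u"
| commute: "fim_cong (u @ inv_word u @ v @ inv_word v) (v @ inv_word v @ u @ inv_word u)"
| refl: "fim_cong u u"
| sym: "fim_cong u v \<Longrightarrow> fim_cong v u"
| trans: "fim_cong u v \<Longrightarrow> fim_cong v w \<Longrightarrow> fim_cong u w"
| append: "fim_cong u u' \<Longrightarrow> fim_cong v v' \<Longrightarrow> fim_cong (u @ v) (u' @ v')"

lemma equivp_fim_cong: "equivp fim_cong"
  by (rule equivpI)
     (auto intro!: reflpI sympI transpI intro: fim_cong.refl fim_cong.sym fim_cong.trans)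

quotient_type 'a fim = "'a letter list" / fim_cong
  by (rule equivp_fim_cong)

instantiation fim :: (type) monoid_mult
begin

lift_definition one_fim :: "'a fim" is "[]" .

lift_definition times_fim :: "'a fim \<Rightarrow> 'a fim \<Rightarrow> 'a fim" is "(@)"
  by (rule fim_cong.append)

instance
  by standard (transfer, simp add: fim_cong.refl)+

end

lift_definition fim_proj :: "'a letter list \<Rightarrow> 'a fim" is "\<lambda>u. u" .

lemma fim_proj_Nil: "fim_proj [] = 1"
  by transfer (rule fim_cong.refl)

lemma fim_proj_append: "fim_proj (u @ v) = fim_proj u * fim_proj v"
  by transfer (rule fim_cong.refl)

lemma fim_proj_eq_iff: "fim_proj u = fim_proj v \<longleftrightarrow> fim_cong u v"
  by transfer simp

lemma surj_fim_proj: "surj fim_proj"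
  unfolding surj_def by (metis Quotient_fim Quotient_abs_rep fim_proj.abs_eq)

definition fim_letters :: "'a fim set" where
  "fim_letters = range (\<lambda>x. fim_proj [x])"

definition fim_endomorphism :: "('a fim \<Rightarrow> 'a fim) \<Rightarrow> bool" where
  "fim_endomorphism \<phi> \<longleftrightarrow> \<phi> 1 = 1 \<and> (\<forall>x y. \<phi> (x * y) = \<phi> x * \<phi> y)"

definition Fix :: "('a fim \<Rightarrow> 'a fim) \<Rightarrow> 'a fim set" where
  "Fix \<phi> = {x. \<phi> x = x}"

datatype ('n, 't) symb = Nt 'n | Tm 't

type_synonym ('n, 't) prods = "('n \<times> ('n, 't) symb list) set"

inductive derive_step :: "('n, 't) prods \<Rightarrow> ('n, 't) symb list \<Rightarrow> ('n, 't) symb list \<Rightarrow> bool"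
  for P where
  "(B, w) \<in> P \<Longrightarrow> derive_step P (u @ [Nt B] @ v) (u @ w @ v)"

definition generated_language :: "('n, 't) prods \<Rightarrow> 'n \<Rightarrow> 't list set" where
  "generated_language P S = {w. (derive_step P)\<^sup>*\<^sup>* [Nt S] (map Tm w)}"

text \<open>Only finitely many nonterminals matter in a grammar with finitely many productions, so
  taking them from \<^typ>\<open>nat\<close> is no restriction.\<close>

definition context_free :: "'t list set \<Rightarrow> bool" where
  "context_free L \<longleftrightarrow>
     (\<exists>(P :: (nat, 't) prods) S. finite P \<and> L = generated_language P S)"

definition fim_context_free :: "'a fim set \<Rightarrow> bool" where
  "fim_context_free X \<longleftrightarrow> (\<exists>L. context_free L \<and> X = fim_proj ` L)"

end

theory Submission
  imports Defs
begin

text \<open>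
  Reading a word letter by letter traces a walk in the Cayley tree of the free group, and the
  endpoint and the set of visited vertices depend only on the image of the word in the free
  inverse monoid (one half of Munn's theorem; \<open>fim_cong_walk\<close>, \<open>fim_cong_visited\<close>). The
  endomorphism is induced by a permutation \<open>\<sigma>\<close> of the letters that commutes with inversion, so
  it acts on the tree letter by letter. Since \<open>\<sigma>\<close> has no fixed letter, a word representing a
  fixed point has trivial value in the free group, and the set of vertices that it visits is
  invariant under \<open>\<sigma>\<close>.

  Suppose that a grammar generates only such words. If a useful nonterminal derives itself in the
  context \<open>x _ y\<close>, then \<open>x\<close> has trivial value (\<open>pumped_factor_trivial\<close>). Otherwise, pumping
  \<open>p x\<^sup>k w y\<^sup>k q\<close> makes the vertices \<open>p x\<^sup>k\<close> run off to infinity; they eventually all have the same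
  first letter \<open>b\<close>. Triviality of all the pumped words forces \<open>y\<close> to undo what \<open>x\<close> does, so the
  whole walk stays within a distance independent of \<open>k\<close> from the vertices \<open>p x\<^sup>j\<close>. But the image
  of a distant vertex \<open>p x\<^sup>k\<close> under \<open>\<sigma>\<close> is visited as well, it starts with \<open>\<sigma> b \<noteq> b\<close>, and therefore
  it is far from all of them.

  So going down a derivation tree, a nonterminal that reappears does so at the same vertex. The
  vertices at which nonterminals are entered are then as few steps from the root as there are
  nonterminals, each step of bounded length, and all words of the language stay in one ball
  (\<open>walk_bounded\<close>). The fixed points do not: multiplying the idempotents
  \<open>b\<^sup>n b\<^sup>-\<^sup>n\<close> over the orbit of a letter \<open>b\<close> gives fixed points that visit vertices at every distance.
\<close>

section \<open>Walks in the Cayley tree of the free group\<close>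

text \<open>Vertices are reduced words stored in reverse order: the head is the last letter read, so
  that a step of the walk is a push or a pop.\<close>

definition reduced :: "'a letter list \<Rightarrow> bool" where
  "reduced = successively (\<lambda>a b. b \<noteq> inv_letter a)"

fun tree_step :: "'a letter list \<Rightarrow> 'a letter \<Rightarrow> 'a letter list" where
  "tree_step [] x = [x]"
| "tree_step (y # s) x = (if x = inv_letter y then s else x # y # s)"

definition walk :: "'a letter list \<Rightarrow> 'a letter list \<Rightarrow> 'a letter list" where
  "walk = foldl tree_step"

definition visited :: "'a letter list \<Rightarrow> 'a letter list \<Rightarrow> 'a letter list set" where
  "visited s w = {walk s u |u v. w = u @ v}"

abbreviation word_power :: "'b list \<Rightarrow> nat \<Rightarrow> 'b list" where
  "word_power x k \<equiv> concat (replicate k x)"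

lemma word_power_add: "word_power x (i + j) = word_power x i @ word_power x j"
  by (simp add: replicate_add)

lemma inv_letter_neq [simp]: "inv_letter x \<noteq> x" "x \<noteq> inv_letter x"
  by (cases x; simp)+

lemma inv_letter_eq_iff: "inv_letter x = y \<longleftrightarrow> x = inv_letter y"
  by auto

lemma length_inv_word [simp]: "length (inv_word u) = length u"
  by (simp add: inv_word_def)

lemma inv_word_Cons: "inv_word (x # u) = inv_word u @ [inv_letter x]"
  by (simp add: inv_word_def)

lemma reduced_Nil [simp]: "reduced []"
  by (simp add: reduced_def)

lemma reduced_rev [simp]: "reduced (rev s) = reduced s"
proof -
  have "(\<lambda>a b. a \<noteq> inv_letter b) = (\<lambda>a b::'a letter. b \<noteq> inv_letter a)"
    by (intro ext) auto
  then show ?thesis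
    by (simp only: reduced_def successively_rev)
qed

lemma reduced_append_iff:
  "reduced (u @ v) \<longleftrightarrow>
     reduced u \<and> reduced v \<and> (u \<noteq> [] \<longrightarrow> v \<noteq> [] \<longrightarrow> hd v \<noteq> inv_letter (last u))"
  by (auto simp: reduced_def successively_append_iff)

lemma reduced_Cons_iff:
  "reduced (x # s) \<longleftrightarrow> reduced s \<and> (s \<noteq> [] \<longrightarrow> hd s \<noteq> inv_letter x)"
  using reduced_append_iff[of "[x]" s] by (auto simp: reduced_def)

lemma walk_Nil [simp]: "walk s [] = s"
  and walk_Cons: "walk s (x # w) = walk (tree_step s x) w"
  and walk_append: "walk s (u @ v) = walk (walk s u) v"
  by (simp_all add: walk_def)

lemma reduced_tree_step: "reduced s \<Longrightarrow> reduced (tree_step s x)"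
  by (cases s) (auto simp: reduced_Cons_iff inv_letter_eq_iff)

lemma reduced_walk: "reduced s \<Longrightarrow> reduced (walk s w)"
  by (induction w arbitrary: s) (auto simp: walk_Cons reduced_tree_step)

lemma tree_step_inverse: "reduced s \<Longrightarrow> tree_step (tree_step s x) (inv_letter x) = s"
  by (cases s; cases "tl s") (auto simp: reduced_Cons_iff)

lemma walk_inv_word: "reduced s \<Longrightarrow> walk (walk s u) (inv_word u) = s"
  by (induction u arbitrary: s)
     (auto simp: walk_Cons inv_word_Cons walk_append reduced_tree_step tree_step_inverse)

lemma walk_inv_word': "reduced s \<Longrightarrow> walk (walk s (inv_word u)) u = s"
  using walk_inv_word[of s "inv_word u"] by simp

lemma walk_reduced: "reduced (rev s @ w) \<Longrightarrow> walk s w = rev w @ s"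
proof (induction w arbitrary: s)
  case (Cons x w)
  have "tree_step s x = x # s"
    using Cons.prems by (cases s) (auto simp: reduced_append_iff reduced_Cons_iff)
  then show ?case
    using Cons by (simp add: walk_Cons)
qed simp

text \<open>Translating the tree by \<open>s\<close>: a walk has the same effect as the geodesic that joins its
  endpoints.\<close>

lemma walk_normal_form:
  assumes "reduced s"
  shows "walk s u = walk s (rev (walk [] u))"
proof (induction u rule: rev_induct)
  case (snoc x u)
  show ?case
  proof (cases "walk [] u")
    case Nil
    then show ?thesis
      using snoc by (simp add: walk_append walk_Cons)
  next
    case (Cons y t)
    have "walk s u = tree_step (walk s (rev t)) y"
      using snoc Cons by (simp add: walk_append walk_Cons)
    then show ?thesis
      using Cons assms tree_step_inverse[of "walk s (rev t)" y]
      by (simp add: walk_append walk_Cons reduced_walk)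
  qed
qed simp

lemma length_tree_step:
  "length (tree_step s x) \<le> Suc (length s)" "length s \<le> Suc (length (tree_step s x))"
  by (cases s; simp)+

lemma length_walk_upper: "length (walk s w) \<le> length s + length w"
proof (induction w arbitrary: s)
  case (Cons x w)
  show ?case
    using Cons[of "tree_step s x"] length_tree_step(1)[of s x] by (simp add: walk_Cons)
qed simp

text \<open>A walk shorter than the distance to the root never leaves the branch it starts in; the last
  entry of a vertex is the first letter of the word it stands for.\<close>

lemma short_walk_same_branch:
  "length w < length s \<Longrightarrow> walk s w \<noteq> [] \<and> last (walk s w) = last s"
proof (induction w arbitrary: s)
  case (Cons x w)
  have "length w < length (tree_step s x)"
    using Cons.prems length_tree_step(2)[of s x] by simp
  moreover have "last (tree_step s x) = last s"
    using Cons.prems by (cases s) auto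
  ultimately show ?case
    using Cons.IH by (simp add: walk_Cons)
qed auto

lemma visited_append: "visited s (u @ v) = visited s u \<union> visited (walk s u) v"
proof -
  have "visited (walk s u) v = {walk s (u @ a) |a b. v = a @ b}"
    by (simp add: visited_def walk_append)
  moreover have "visited s (u @ v) = visited s u \<union> {walk s (u @ a) |a b. v = a @ b}"
    unfolding visited_def by (auto simp: append_eq_append_conv2)
  ultimately show ?thesis
    by simp
qed

lemma visited_inv_word:
  assumes "reduced s"
  shows "visited (walk s u) (inv_word u) = visited s u"
proof -
  have sub: "visited (walk r v) (inv_word v) \<subseteq> visited r v"
    if "reduced r" for r v :: "'a letter list"
  proof
    fix t
    assume "t \<in> visited (walk r v) (inv_word v)"
    then obtain a b where ab: "inv_word v = a @ b" "t = walk (walk r v) a"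
      by (auto simp: visited_def)
    then have v: "v = inv_word b @ inv_word a"
      by (metis inv_word_append inv_word_inv_word)
    then have "t = walk r (inv_word b)"
      using ab(2) that by (simp add: walk_append walk_inv_word' reduced_walk)
    then show "t \<in> visited r v"
      using v by (auto simp: visited_def)
  qed
  show ?thesis
    using sub[OF assms, of u] sub[OF reduced_walk[OF assms, of u], of "inv_word u"] assms
    by (auto simp: walk_inv_word)
qed

text \<open>The endpoint and the visited vertices are invariants of the free inverse monoid.\<close>

lemma fim_cong_walk: "fim_cong u v \<Longrightarrow> reduced s \<Longrightarrow> walk s u = walk s v"
  by (induction arbitrary: s rule: fim_cong.induct)
     (auto simp: walk_append walk_inv_word reduced_walk)

lemma fim_cong_visited: "fim_cong u v \<Longrightarrow> reduced s \<Longrightarrow> visited s u = visited s v"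
proof (induction arbitrary: s rule: fim_cong.induct)
  case (append u u' v v')
  then show ?case
    using fim_cong_walk[OF append.hyps(1)] by (simp add: visited_append reduced_walk)
qed (auto simp: visited_append walk_inv_word visited_inv_word reduced_walk walk_append)


section \<open>Words equal in the free group\<close>

definition free_eq :: "'a letter list \<Rightarrow> 'a letter list \<Rightarrow> bool" where
  "free_eq u v \<longleftrightarrow> walk [] u = walk [] v"

lemma free_eq_refl [simp]: "free_eq u u"
  and free_eq_sym: "free_eq u v \<Longrightarrow> free_eq v u"
  and free_eq_trans [trans]: "free_eq u v \<Longrightarrow> free_eq v w \<Longrightarrow> free_eq u w"
  by (simp_all add: free_eq_def)

lemma free_eq_walk: "free_eq u v \<Longrightarrow> reduced s \<Longrightarrow> walk s u = walk s v"
  by (metis free_eq_def walk_normal_form)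

lemma free_eq_append: "free_eq u u' \<Longrightarrow> free_eq v v' \<Longrightarrow> free_eq (u @ v) (u' @ v')"
  using free_eq_walk[of v v' "walk [] u"]
  by (simp add: free_eq_def walk_append reduced_walk)

lemma free_eq_inv_right: "free_eq (u @ inv_word u @ v) v"
  and free_eq_inv_left: "free_eq (inv_word u @ u @ v) v"
  by (simp_all add: free_eq_def walk_append walk_inv_word walk_inv_word')

lemma free_eq_rev_walk: "free_eq (rev (walk [] u)) u"
  by (simp add: free_eq_def walk_normal_form[of "[]" u, symmetric])

lemma free_eq_cancel_left:
  assumes "free_eq (p @ u) (p @ v)"
  shows "free_eq u v"
proof -
  have "free_eq (inv_word p @ p @ u) (inv_word p @ p @ v)"
    by (rule free_eq_append[OF free_eq_refl assms])
  then show ?thesis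
    by (meson free_eq_inv_left free_eq_sym free_eq_trans)
qed

lemma free_eq_cancel_right:
  assumes "free_eq (u @ q) (v @ q)"
  shows "free_eq u v"
proof -
  have "walk [] (u @ q @ inv_word q) = walk [] (v @ q @ inv_word q)"
    using free_eq_append[OF assms free_eq_refl[of "inv_word q"]] by (simp add: free_eq_def)
  then show ?thesis
    by (simp add: free_eq_def walk_append walk_inv_word reduced_walk)
qed

lemma free_eq_word_power: "free_eq x y \<Longrightarrow> free_eq (word_power x k) (word_power y k)"
  by (induction k) (auto intro: free_eq_append)

lemma reduced_word_power:
  assumes "reduced (c @ c)"
  shows "reduced (word_power c k)"
proof (induction k)
  case (Suc k)
  then show ?case
    using assms by (cases k) (auto simp: reduced_append_iff)
qed simp

lemma cyclic_reduction:
  "reduced x \<Longrightarrow> x \<noteq> [] \<Longrightarrow>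
     \<exists>u c. x = u @ c @ inv_word u \<and> c \<noteq> [] \<and> reduced (c @ c)"
proof (induction x rule: length_induct)
  case (1 x)
  show ?case
  proof (cases "reduced (x @ x)")
    case True
    then show ?thesis
      using 1 by (intro exI[of _ "[]"] exI[of _ x]) auto
  next
    case False
    then have ends: "hd x = inv_letter (last x)"
      using 1 by (auto simp: reduced_append_iff)
    obtain a x1 where x1: "x = a # x1"
      using 1(3) by (cases x) auto
    then have "x1 \<noteq> []"
      using ends by auto
    then obtain y b where y: "x1 = y @ [b]"
      by (cases x1 rule: rev_cases) auto
    have b: "b = inv_letter a"
      using ends x1 y by simp
    have "reduced y"
      using 1(2) x1 y by (auto simp: reduced_Cons_iff reduced_append_iff)
    moreover have "y \<noteq> []"
      using 1(2) x1 y b by (auto simp: reduced_Cons_iff)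
    ultimately obtain u c where uc: "y = u @ c @ inv_word u" "c \<noteq> []" "reduced (c @ c)"
      using 1(1)[rule_format, of y] x1 y by auto
    then have "x = (a # u) @ c @ inv_word (a # u)"
      using x1 y b by (simp add: inv_word_Cons)
    then show ?thesis
      using uc by blast
  qed
qed

lemma free_eq_conjugate_power:
  "free_eq (word_power (u @ c @ inv_word u) k) (u @ word_power c k @ inv_word u)"
proof (induction k)
  case 0
  then show ?case
    using free_eq_inv_right[of u "[]"] by (simp add: free_eq_sym)
next
  case (Suc k)
  have "free_eq (word_power (u @ c @ inv_word u) (Suc k))
      ((u @ c @ inv_word u) @ u @ word_power c k @ inv_word u)"
    using free_eq_append[OF free_eq_refl[of "u @ c @ inv_word u"] Suc] by simp
  also have "free_eq \<dots> (u @ word_power c (Suc k) @ inv_word u)"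
    using free_eq_append[OF free_eq_refl[of "u @ c"]
        free_eq_inv_left[of u "word_power c k @ inv_word u"]]
    by simp
  finally show ?case .
qed

text \<open>Powers of a nontrivial element grow linearly: for the cyclically reduced part \<open>c\<close> no
  cancellation occurs in \<open>c\<^sup>k\<close>, and conjugating and translating costs only a constant.\<close>

lemma powers_grow:
  assumes "\<not> free_eq x []"
  shows "\<exists>D. \<forall>k. k \<le> length (walk [] (p @ word_power x k)) + D"
proof -
  define x' where "x' = rev (walk [] x)"
  have "reduced x'" "x' \<noteq> []"
    using assms by (auto simp: x'_def free_eq_def reduced_walk)
  then obtain u c where uc: "x' = u @ c @ inv_word u" "c \<noteq> []" "reduced (c @ c)"
    using cyclic_reduction by blast
  have "k \<le> length (walk [] (p @ word_power x k)) + (length p + 2 * length u)" for k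
  proof -
    define g where "g = rev (walk [] (p @ word_power x k))"
    have "free_eq (word_power x k) (word_power x' k)"
      by (intro free_eq_word_power) (simp add: x'_def free_eq_rev_walk free_eq_sym)
    also have "free_eq \<dots> (u @ word_power c k @ inv_word u)"
      unfolding uc(1) by (rule free_eq_conjugate_power)
    finally have "free_eq g (p @ u @ word_power c k @ inv_word u)"
      unfolding g_def by (meson free_eq_append free_eq_refl free_eq_rev_walk free_eq_trans)
    then have "walk [] g = walk [] (p @ u @ word_power c k @ inv_word u)"
      by (simp add: free_eq_def)
    then have "walk (walk [] (inv_word u @ inv_word p)) (g @ u) = walk [] (word_power c k)"
      using free_eq_walk[of g "p @ u @ word_power c k @ inv_word u"
          "walk [] (inv_word u @ inv_word p)"]
      by (simp add: free_eq_def walk_append walk_inv_word' reduced_walk)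
    also have "\<dots> = rev (word_power c k)"
      using walk_reduced[of "[]" "word_power c k"] reduced_word_power[OF uc(3)] by simp
    finally have "length (word_power c k) = length (walk [] (inv_word u @ inv_word p @ g @ u))"
      by (metis append.assoc length_rev walk_append)
    also have "\<dots> \<le> length p + 2 * length u + length g"
      using length_walk_upper[of "[]" "inv_word u @ inv_word p @ g @ u"] by simp
    finally have "length (word_power c k) \<le> length g + (length p + 2 * length u)"
      by simp
    moreover have "k \<le> length (word_power c k)"
      using uc(2) by (cases c; induction k) auto
    ultimately show ?thesis
      by (simp add: g_def)
  qed
  then show ?thesis
    by blast
qed


section \<open>The endomorphism as a permutation of the letters\<close>

lemma map_inv_word:
  assumes "\<And>x. \<sigma> (inv_letter x) = inv_letter (\<sigma> x)"
  shows "map \<sigma> (inv_word u) = inv_word (map \<sigma> u)"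
  using assms by (simp add: inv_word_def rev_map)

lemma fim_proj_letter_inj:
  assumes "fim_proj [x] = fim_proj [y]"
  shows "x = y"
  using assms fim_cong_walk[of "[x]" "[y]" "[]"] by (simp add: fim_proj_eq_iff walk_Cons)

text \<open>That \<open>\<sigma>\<close> commutes with inversion has to be read off from the relation
  \<open>x x\<^sup>-\<^sup>1 x = x\<close>: its image \<open>y z y = y\<close> can hold for letters only if \<open>z\<close> is the inverse of \<open>y\<close>.\<close>

lemma letter_permutation:
  fixes \<phi> :: "'a fim \<Rightarrow> 'a fim"
  assumes hom: "fim_endomorphism \<phi>"
    and bij: "bij_betw \<phi> fim_letters fim_letters"
    and fpf: "\<forall>x\<in>fim_letters. \<phi> x \<noteq> x"
  obtains \<sigma> :: "'a letter \<Rightarrow> 'a letter" where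
    "inj \<sigma>" "\<And>x. \<sigma> (inv_letter x) = inv_letter (\<sigma> x)" "\<And>x. \<sigma> x \<noteq> x"
    "\<And>w. \<phi> (fim_proj w) = fim_proj (map \<sigma> w)"
proof -
  have "\<exists>y. \<phi> (fim_proj [x]) = fim_proj [y]" for x
    using bij by (auto simp: bij_betw_def fim_letters_def)
  then obtain \<sigma> where \<sigma>: "\<And>x. \<phi> (fim_proj [x]) = fim_proj [\<sigma> x]"
    by metis
  have word: "\<phi> (fim_proj w) = fim_proj (map \<sigma> w)" for w
  proof (induction w)
    case Nil
    then show ?case
      using hom by (simp add: fim_endomorphism_def fim_proj_Nil)
  next
    case (Cons x w)
    then show ?case
      using hom \<sigma>[of x] fim_proj_append[of "[x]" w] fim_proj_append[of "[\<sigma> x]" "map \<sigma> w"]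
      by (simp add: fim_endomorphism_def)
  qed
  have "inj \<sigma>"
  proof
    fix x y
    assume "\<sigma> x = \<sigma> y"
    then have "\<phi> (fim_proj [x]) = \<phi> (fim_proj [y])"
      by (simp add: \<sigma>)
    then have "fim_proj [x] = fim_proj [y]"
      using bij by (auto simp: bij_betw_def fim_letters_def dest: inj_onD)
    then show "x = y"
      by (rule fim_proj_letter_inj)
  qed
  moreover have "\<sigma> (inv_letter x) = inv_letter (\<sigma> x)" for x
  proof -
    have "fim_proj [x, inv_letter x, x] = fim_proj [x]"
      using fim_cong.regular[of "[x]"] by (simp add: fim_proj_eq_iff inv_word_def)
    then have "fim_proj (map \<sigma> [x, inv_letter x, x]) = fim_proj (map \<sigma> [x])"
      by (metis word)
    then have "walk [] (map \<sigma> [x, inv_letter x, x]) = walk [] (map \<sigma> [x])"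
      using fim_cong_walk reduced_Nil unfolding fim_proj_eq_iff by blast
    then show ?thesis
      by (auto simp: walk_Cons split: if_splits)
  qed
  moreover have "\<sigma> x \<noteq> x" for x
    using fpf \<sigma>[of x] by (auto simp: fim_letters_def)
  ultimately show ?thesis
    using that word by blast
qed

locale free_letter_permutation =
  fixes \<sigma> :: "'a letter \<Rightarrow> 'a letter"
  assumes inj: "inj \<sigma>"
    and inv: "\<And>x. \<sigma> (inv_letter x) = inv_letter (\<sigma> x)"
    and no_fixed_letter: "\<And>x. \<sigma> x \<noteq> x"
begin

lemma tree_step_map: "tree_step (map \<sigma> s) (\<sigma> x) = map \<sigma> (tree_step s x)"
  by (cases s) (auto simp: inv[symmetric] inj_eq[OF inj])

lemma walk_map: "walk (map \<sigma> s) (map \<sigma> w) = map \<sigma> (walk s w)"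
  by (induction w arbitrary: s) (auto simp: walk_Cons tree_step_map)

text \<open>The visited vertices are the only part of the Munn tree of a fixed point that carries
  information, as its endpoint is the root.\<close>

lemma fixed_word:
  assumes "fim_cong (map \<sigma> w) w"
  shows "free_eq w []"
    and "t \<in> visited [] w \<Longrightarrow> map \<sigma> t \<in> visited [] w"
proof -
  have "map \<sigma> (walk [] w) = walk [] w"
    using walk_map[of "[]" w] fim_cong_walk[OF assms reduced_Nil] by simp
  then show "free_eq w []"
    using no_fixed_letter by (cases "walk [] w") (auto simp: free_eq_def)
  assume "t \<in> visited [] w"
  then obtain u v where "w = u @ v" "t = walk [] u"
    by (auto simp: visited_def)
  then have "map \<sigma> t \<in> visited [] (map \<sigma> w)"
    using walk_map[of "[]" u, symmetric] by (auto simp: visited_def)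
  then show "map \<sigma> t \<in> visited [] w"
    using fim_cong_visited[OF assms reduced_Nil] by simp
qed

end


section \<open>Pumping a word that stays in the fixed point set\<close>

lemma word_power_split:
  "word_power x k = a @ b \<Longrightarrow>
     \<exists>i r. i \<le> k \<and> a = word_power x i @ r \<and> length r \<le> length x"
proof (induction k arbitrary: a)
  case (Suc k)
  from Suc.prems consider r where "x = a @ r"
    | a' where "a = x @ a'" "word_power x k = a' @ b"
    by (auto simp: append_eq_append_conv2)
  then show ?case
  proof cases
    case 1
    then show ?thesis
      by (intro exI[of _ 0] exI[of _ a]) auto
  next
    case 2
    then obtain i r where "i \<le> k" "a' = word_power x i @ r" "length r \<le> length x"
      using Suc.IH by blast
    then show ?thesis
      using 2 by (intro exI[of _ "Suc i"] exI[of _ r]) auto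
  qed
qed simp

text \<open>Because \<open>x\<^sup>i w y\<^sup>i\<close> has the same value for all \<open>i\<close>, the walk along \<open>y\<^sup>k\<close> retraces the walk
  along \<open>x\<^sup>k\<close> at a bounded distance.\<close>

lemma visited_pumped:
  assumes triv: "\<And>k. free_eq (p @ word_power x k @ w @ word_power y k @ q) []"
    and t: "t \<in> visited [] (p @ word_power x k @ w @ word_power y k @ q)"
  shows "\<exists>j v. j \<le> k \<and> t = walk (walk [] (p @ word_power x j)) v \<and>
    length v \<le> 2 * length p + 2 * length q + length x + length y + length w"
proof -
  have mid: "walk s (word_power x i @ w @ word_power y i) = walk s (inv_word p @ inv_word q)"
    if "reduced s" for s i
  proof -
    have "free_eq (p @ word_power x i @ w @ word_power y i @ q) (p @ inv_word p @ inv_word q @ q)"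
      using triv[of i] free_eq_inv_right[of p "inv_word q @ q"] free_eq_inv_left[of q "[]"]
      by (metis append_Nil2 free_eq_sym free_eq_trans)
    then have "free_eq (word_power x i @ w @ word_power y i @ q) (inv_word p @ inv_word q @ q)"
      by (rule free_eq_cancel_left)
    then have "free_eq (word_power x i @ w @ word_power y i) (inv_word p @ inv_word q)"
      using free_eq_cancel_right[of _ q] by simp
    then show ?thesis
      using that by (rule free_eq_walk)
  qed
  have after: "walk [] (p @ word_power x k @ w @ word_power y i @ r) =
      walk (walk [] (p @ word_power x (k - i))) (inv_word p @ inv_word q @ r)"
    if "i \<le> k" for i r
  proof -
    have "p @ word_power x k @ w @ word_power y i @ r =
        (p @ word_power x (k - i)) @ (word_power x i @ w @ word_power y i) @ r"
      using word_power_add[of "k - i" i x] that by simp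
    then have "walk [] (p @ word_power x k @ w @ word_power y i @ r) =
        walk (walk (walk [] (p @ word_power x (k - i))) (word_power x i @ w @ word_power y i)) r"
      by (metis walk_append)
    also have "\<dots> = walk (walk (walk [] (p @ word_power x (k - i))) (inv_word p @ inv_word q)) r"
      by (subst mid) (auto simp: reduced_walk)
    finally show ?thesis
      by (simp add: walk_append)
  qed
  obtain u z where uz: "p @ word_power x k @ w @ word_power y k @ q = u @ z" "t = walk [] u"
    using t by (auto simp: visited_def)
  consider (p) r where "p = u @ r"
    | (x) a b where "u = p @ a" "word_power x k = a @ b"
    | (w) a b where "u = p @ word_power x k @ a" "w = a @ b"
    | (y) a b where "u = p @ word_power x k @ w @ a" "word_power y k = a @ b"
    | (q) a where "u = p @ word_power x k @ w @ word_power y k @ a" "q = a @ z"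
    using uz(1) by (auto simp: append_eq_append_conv2)
  then show ?thesis
  proof cases
    case p
    then have "t = walk (walk [] (p @ word_power x 0)) (inv_word r)"
      using uz(2) by (simp add: walk_append walk_inv_word reduced_walk)
    then show ?thesis
      using p by (intro exI[of _ 0] exI[of _ "inv_word r"]) auto
  next
    case x
    then obtain i r where "i \<le> k" "a = word_power x i @ r" "length r \<le> length x"
      using word_power_split by blast
    then show ?thesis
      using x uz(2) by (intro exI[of _ i] exI[of _ r]) (auto simp: walk_append)
  next
    case w
    then show ?thesis
      using uz(2) by (intro exI[of _ k] exI[of _ a]) (auto simp: walk_append)
  next
    case y
    then obtain i r where "i \<le> k" "a = word_power y i @ r" "length r \<le> length y"
      using word_power_split by blast
    then show ?thesis
      using y uz(2) after[of i r]
      by (intro exI[of _ "k - i"] exI[of _ "inv_word p @ inv_word q @ r"]) auto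
  next
    case q
    have "length a \<le> length q"
      using q(2) by simp
    then show ?thesis
      using q uz(2) after[of k a]
      by (intro exI[of _ 0] exI[of _ "inv_word p @ inv_word q @ a"]) auto
  qed
qed

lemma (in free_letter_permutation) pumped_factor_trivial:
  assumes fixed: "\<And>k. fim_cong (map \<sigma> (p @ word_power x k @ w @ word_power y k @ q))
      (p @ word_power x k @ w @ word_power y k @ q)"
  shows "free_eq x []"
proof (rule ccontr)
  assume "\<not> free_eq x []"
  define s where "s k = walk [] (p @ word_power x k)" for k
  obtain D where D: "\<And>k. k \<le> length (s k) + D"
    using powers_grow[OF \<open>\<not> free_eq x []\<close>] unfolding s_def by blast
  define C where "C = 2 * length p + 2 * length q + length x + length y + length w"
  \<comment> \<open>From \<open>K\<close> on, one more factor \<open>x\<close> is too short to change the branch.\<close>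
  define K where "K = length x + D + 1"
  have "s (Suc k) = walk (s k) x" for k
    using word_power_add[of k 1 x] by (simp add: s_def walk_append)
  then have same: "last (s (Suc k)) = last (s k)" if "K \<le> k" for k
    using short_walk_same_branch[of x "s k"] D[of k] that by (simp add: K_def)
  have branch: "last (s k) = last (s K)" if "K \<le> k" for k
    using that by (induction rule: dec_induct) (auto simp: same)
  define R where "R = length p + K * length x"
  have early: "length (s j) \<le> R" if "j < K" for j
  proof -
    have "length (word_power x j) = j * length x"
      by (induction j) auto
    moreover have "j * length x \<le> K * length x"
      using that by (intro mult_right_mono) auto
    moreover have "length (s j) \<le> length p + length (word_power x j)"
      using length_walk_upper[of "[]" "p @ word_power x j"] by (simp add: s_def)
    ultimately show ?thesis
      by (simp only: R_def)
  qed
  \<comment> \<open>The vertex \<open>s k\<close> is so far out that everything within distance \<open>C\<close> of its image is farther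
    than \<open>C\<close> from the root and is none of the vertices before \<open>s K\<close>.\<close>
  define k where "k = K + R + 2 * C + D + 1"
  have far: "R + 2 * C < length (s k)"
    using D[of k] by (simp add: k_def)
  let ?W = "p @ word_power x k @ w @ word_power y k @ q"
  have "s k \<in> visited [] ?W"
    unfolding visited_def s_def
    by (intro CollectI exI[of _ "p @ word_power x k"] exI[of _ "w @ word_power y k @ q"]) simp
  then have "map \<sigma> (s k) \<in> visited [] ?W"
    by (rule fixed_word(2)[OF fixed])
  then obtain j v where jv: "map \<sigma> (s k) = walk (s j) v" "length v \<le> C"
    using visited_pumped[OF fixed_word(1)[OF fixed]] unfolding s_def C_def by blast
  have "length (s k) \<le> length (s j) + length v"
    using length_walk_upper[of "s j" v] jv(1) by (metis length_map)
  then have long: "R + C < length (s j)"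
    using far jv(2) by simp
  then have "K \<le> j"
    using early[of j] by (cases "j < K") auto
  have "last (map \<sigma> (s k)) = last (s j)"
    using short_walk_same_branch[of v "s j"] long jv by simp
  moreover have "last (map \<sigma> (s k)) = \<sigma> (last (s k))"
    using far by (intro last_map) auto
  ultimately show False
    using branch[OF \<open>K \<le> j\<close>] branch[of k] no_fixed_letter[of "last (s K)"]
    by (simp add: k_def)
qed


section \<open>Derivation trees and the vertices at which they enter nonterminals\<close>

inductive yields :: "('n, 't) prods \<Rightarrow> ('n, 't) symb list \<Rightarrow> 't list \<Rightarrow> bool" for P where
  Nil: "yields P [] []"
| Tm: "yields P \<alpha> w \<Longrightarrow> yields P (Tm t # \<alpha>) (t # w)"
| Nt: "(N, \<beta>) \<in> P \<Longrightarrow> yields P \<beta> u \<Longrightarrow> yields P \<alpha> w \<Longrightarrow> yields P (Nt N # \<alpha>) (u @ w)"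

lemma yields_Nil_iff [simp]: "yields P [] w \<longleftrightarrow> w = []"
  by (auto intro: yields.Nil elim: yields.cases)

lemma yields_append: "yields P \<alpha> u \<Longrightarrow> yields P \<beta> v \<Longrightarrow> yields P (\<alpha> @ \<beta>) (u @ v)"
  by (induction rule: yields.induct) (auto intro: yields.intros)

lemma yields_append_cases:
  assumes "yields P (\<alpha> @ \<beta>) w"
  obtains u v where "w = u @ v" "yields P \<alpha> u" "yields P \<beta> v"
proof -
  have "\<exists>u v. w = u @ v \<and> yields P \<alpha> u \<and> yields P \<beta> v"
    using assms
  proof (induction \<alpha> arbitrary: w)
    case Nil
    then show ?case
      by (auto intro: yields.Nil)
  next
    case (Cons X \<alpha>)
    from Cons.prems have "yields P (X # \<alpha> @ \<beta>) w"
      by simp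
    then show ?case
    proof cases
      case (Tm w' t)
      then obtain u v where "w' = u @ v" "yields P \<alpha> u" "yields P \<beta> v"
        using Cons.IH by blast
      then show ?thesis
        using Tm by (intro exI[of _ "t # u"] exI[of _ v]) (auto intro: yields.Tm)
    next
      case (Nt N \<gamma> a b)
      then obtain u v where "b = u @ v" "yields P \<alpha> u" "yields P \<beta> v"
        using Cons.IH by blast
      then show ?thesis
        using Nt by (intro exI[of _ "a @ u"] exI[of _ v]) (auto intro: yields.Nt)
    qed
  qed
  then show ?thesis
    using that by blast
qed

lemma yields_nonterminal: "yields P [Nt N] w \<longleftrightarrow> (\<exists>\<beta>. (N, \<beta>) \<in> P \<and> yields P \<beta> w)"
proof
  assume "yields P [Nt N] w"
  then show "\<exists>\<beta>. (N, \<beta>) \<in> P \<and> yields P \<beta> w"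
    by cases auto
next
  assume "\<exists>\<beta>. (N, \<beta>) \<in> P \<and> yields P \<beta> w"
  then show "yields P [Nt N] w"
    using yields.Nt[OF _ _ yields.Nil] by fastforce
qed

lemma derive_step_yields: "derive_step P \<alpha> \<alpha>' \<Longrightarrow> yields P \<alpha>' w \<Longrightarrow> yields P \<alpha> w"
proof (induction rule: derive_step.induct)
  case (1 B v u z)
  then obtain a b c where "w = a @ b @ c" "yields P u a" "yields P v b" "yields P z c"
    by (elim yields_append_cases) auto
  then show ?case
    using 1(1) by (simp only:) (intro yields_append, auto simp: yields_nonterminal)
qed

lemma yields_terminals: "yields P (map Tm w) w"
  by (induction w) (auto intro: yields.intros)

lemma derive_steps_context:
  "(derive_step P)\<^sup>*\<^sup>* \<alpha> \<alpha>' \<Longrightarrow> (derive_step P)\<^sup>*\<^sup>* (\<mu> @ \<alpha> @ \<nu>) (\<mu> @ \<alpha>' @ \<nu>)"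
proof (induction rule: rtranclp_induct)
  case (step \<beta> \<gamma>)
  from step.hyps(2) have "derive_step P (\<mu> @ \<beta> @ \<nu>) (\<mu> @ \<gamma> @ \<nu>)"
  proof cases
    case (1 B w u v)
    then show ?thesis
      using derive_step.intros[OF 1(3), of "\<mu> @ u" "v @ \<nu>"] by simp
  qed
  then show ?case
    using step.IH by simp
qed simp

lemma yields_derives: "yields P \<alpha> w \<Longrightarrow> (derive_step P)\<^sup>*\<^sup>* \<alpha> (map Tm w)"
proof (induction rule: yields.induct)
  case (Tm \<alpha> w t)
  then show ?case
    using derive_steps_context[of P \<alpha> "map Tm w" "[Tm t]" "[]"] by simp
next
  case (Nt N \<beta> u \<alpha> w)
  have "derive_step P (Nt N # \<alpha>) (\<beta> @ \<alpha>)"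
    using derive_step.intros[OF Nt.hyps(1), of "[]" \<alpha>] by simp
  also have "(derive_step P)\<^sup>*\<^sup>* (\<beta> @ \<alpha>) (map Tm u @ \<alpha>)"
    using derive_steps_context[OF Nt.IH(1), of "[]" \<alpha>] by simp
  also have "(derive_step P)\<^sup>*\<^sup>* (map Tm u @ \<alpha>) (map Tm (u @ w))"
    using derive_steps_context[OF Nt.IH(2), of "map Tm u" "[]"] by simp
  finally show ?case .
qed simp

lemma generated_language_yields: "generated_language P S = {w. yields P [Nt S] w}"
proof -
  have "yields P \<alpha> w" if "(derive_step P)\<^sup>*\<^sup>* \<alpha> (map Tm w)" for \<alpha> w
    using that
    by (induction rule: converse_rtranclp_induct)
       (auto intro: yields_terminals derive_step_yields)
  then show ?thesis
    by (auto simp: generated_language_def intro: yields_derives)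
qed

text \<open>A node of a derivation tree is described by its nonterminal and the vertex that the walk has
  reached when the node's yield begins. The side conditions keep only those nodes that occur in a
  derivation of some word.\<close>

inductive child :: "('n, 'a letter) prods \<Rightarrow> 'n \<times> 'a letter list \<Rightarrow> 'n \<times> 'a letter list \<Rightarrow> bool"
  for P where
  "(M, \<alpha> @ Nt N # \<beta>) \<in> P \<Longrightarrow> yields P \<alpha> x \<Longrightarrow> yields P [Nt N] u \<Longrightarrow> yields P \<beta> y \<Longrightarrow>
     child P (M, g) (N, walk g x)"

lemma descendant_context:
  assumes "(child P)\<^sup>*\<^sup>* (M, g) (N, h)"
  shows "\<exists>x y. h = walk g x \<and> (\<forall>w. yields P [Nt N] w \<longrightarrow> yields P [Nt M] (x @ w @ y))"
  using assms
proof (induction "(N, h)" arbitrary: N h rule: rtranclp_induct)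
  case base
  show ?case
    by (intro exI[of _ "[]"]) simp
next
  case (step b)
  obtain M' g' where b: "b = (M', g')"
    by fastforce
  then obtain x y where xy: "g' = walk g x"
      "\<And>w. yields P [Nt M'] w \<Longrightarrow> yields P [Nt M] (x @ w @ y)"
    using step(3) by blast
  from step(2)[unfolded b] obtain \<alpha> \<beta> x' y' where
    c: "(M', \<alpha> @ Nt N # \<beta>) \<in> P" "yields P \<alpha> x'" "yields P \<beta> y'" "h = walk g' x'"
    by cases auto
  have "yields P [Nt M'] (x' @ w @ y')" if "yields P [Nt N] w" for w
    using c yields_append[OF c(2) yields_append[OF that c(3)]]
    by (auto simp: yields_nonterminal)
  then show ?case
    using xy c(4) by (intro exI[of _ "x @ x'"] exI[of _ "y' @ y"]) (fastforce simp: walk_append)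
qed

locale fixed_word_grammar = free_letter_permutation \<sigma>
  for \<sigma> :: "'a letter \<Rightarrow> 'a letter" +
  fixes P :: "('n, 'a letter) prods" and S :: 'n
  assumes finite_prods: "finite P"
    and fixed: "\<And>w. yields P [Nt S] w \<Longrightarrow> fim_cong (map \<sigma> w) w"
begin

abbreviation entered :: "'n \<Rightarrow> 'a letter list \<Rightarrow> bool" where
  "entered M g \<equiv> (child P)\<^sup>*\<^sup>* (S, []) (M, g)"

lemma reduced_entered: "entered M g \<Longrightarrow> reduced g"
  using descendant_context by (metis reduced_Nil reduced_walk)

lemma repeated_nonterminal_same_vertex:
  assumes "entered M g" "(child P)\<^sup>*\<^sup>* (M, g) (M, h)" "yields P [Nt M] w"
  shows "h = g"
proof -
  obtain p q where pq: "\<And>w. yields P [Nt M] w \<Longrightarrow> yields P [Nt S] (p @ w @ q)"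
    using descendant_context[OF assms(1)] by blast
  obtain x y where xy: "h = walk g x"
      "\<And>w. yields P [Nt M] w \<Longrightarrow> yields P [Nt M] (x @ w @ y)"
    using descendant_context[OF assms(2)] by blast
  have "yields P [Nt M] (word_power x k @ w @ word_power y k)" for k
  proof (induction k)
    case (Suc k)
    have "word_power y k @ y = word_power y (Suc k)"
      using word_power_add[of k 1 y] by simp
    then show ?case
      using xy(2)[OF Suc] by simp
  qed (simp add: assms(3))
  then have "free_eq x []"
    using pq fixed by (intro pumped_factor_trivial[of p x w y q]) fastforce
  then show ?thesis
    using xy(1) free_eq_walk[of x "[]" g] reduced_entered[OF assms(1)] by simp
qed

text \<open>Between entering a node and reaching a position between two symbols of its production, the
  walk makes only finitely many different displacements: in a context in which all completions are
  trivial, all words derived from one sentential form have the same value.\<close>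

lemma displacement_bounded:
  obtains C where "\<And>M \<delta> \<gamma> g d z.
    (M, \<delta> @ \<gamma>) \<in> P \<Longrightarrow> entered M g \<Longrightarrow> yields P \<delta> d \<Longrightarrow> yields P \<gamma> z \<Longrightarrow>
      length (walk g d) \<le> length g + C"
proof -
  define useful where "useful \<delta> d \<longleftrightarrow> yields P \<delta> d \<and>
    (\<exists>M \<gamma> g z. (M, \<delta> @ \<gamma>) \<in> P \<and> entered M g \<and> yields P \<gamma> z)" for \<delta> d
  have unique: "walk [] d = walk [] d'" if d: "useful \<delta> d" and d': "useful \<delta> d'" for \<delta> d d'
  proof -
    obtain M \<gamma> g z where M: "(M, \<delta> @ \<gamma>) \<in> P" "entered M g" "yields P \<gamma> z"
      using d by (auto simp: useful_def)
    obtain p q where pq: "\<And>w. yields P [Nt M] w \<Longrightarrow> yields P [Nt S] (p @ w @ q)"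
      using descendant_context[OF M(2)] by blast
    have "free_eq (p @ (e @ z) @ q) []" if "useful \<delta> e" for e
      using that M yields_append[of P \<delta> e \<gamma> z]
      by (intro fixed_word(1) fixed pq) (auto simp: yields_nonterminal useful_def)
    then have "free_eq (p @ d @ z @ q) (p @ d' @ z @ q)"
      using d d' by (metis append.assoc free_eq_sym free_eq_trans)
    then have "free_eq (d @ z @ q) (d' @ z @ q)"
      by (rule free_eq_cancel_left)
    then show ?thesis
      using free_eq_cancel_right by (metis free_eq_def)
  qed
  define F where "F = (\<Union>(M, \<beta>)\<in>P. (\<lambda>n. take n \<beta>) ` {..length \<beta>})"
  have "finite F"
    unfolding F_def using finite_prods by auto
  have "\<delta> \<in> F" if "useful \<delta> d" for \<delta> d
    using that unfolding F_def useful_def by (fastforce intro!: image_eqI[of _ _ "length \<delta>"])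
  then have "{walk [] d |\<delta> d. useful \<delta> d} \<subseteq> (\<Union>\<delta>\<in>F. {walk [] d |d. useful \<delta> d})"
    by blast
  moreover have "finite {walk [] d |d. useful \<delta> d}" for \<delta>
  proof (cases "\<exists>d. useful \<delta> d")
    case True
    then obtain d where "useful \<delta> d" ..
    then have "{walk [] d |d. useful \<delta> d} \<subseteq> {walk [] d}"
      using unique by blast
    then show ?thesis
      by (rule finite_subset) simp
  qed auto
  ultimately have fin: "finite {walk [] d |\<delta> d. useful \<delta> d}"
    using \<open>finite F\<close> by (meson finite_UN finite_subset)
  define C where "C = Max (length ` {walk [] d |\<delta> d. useful \<delta> d})"
  have "length (walk g d) \<le> length g + C"
    if "(M, \<delta> @ \<gamma>) \<in> P" "entered M g" "yields P \<delta> d" "yields P \<gamma> z" for M \<delta> \<gamma> g d z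
  proof -
    have "useful \<delta> d"
      using that by (auto simp: useful_def)
    then have "length (walk [] d) \<le> C"
      unfolding C_def using fin by (intro Max_ge) auto
    then show ?thesis
      using length_walk_upper[of g "rev (walk [] d)"]
        walk_normal_form[OF reduced_entered[OF that(2)], of d] by simp
  qed
  then show ?thesis
    using that by blast
qed

text \<open>Along a path of the derivation tree, the set \<open>A\<close> collects the first occurrence of each
  nonterminal. A later occurrence of the same nonterminal adds nothing new, so the distance from
  the root grows only when \<open>A\<close> does.\<close>

lemma entry_bounded:
  obtains B where "\<And>M g. entered M g \<Longrightarrow> length g \<le> B"
proof -
  obtain C where C: "\<And>M \<delta> \<gamma> g d z.
    (M, \<delta> @ \<gamma>) \<in> P \<Longrightarrow> entered M g \<Longrightarrow> yields P \<delta> d \<Longrightarrow> yields P \<gamma> z \<Longrightarrow>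
      length (walk g d) \<le> length g + C"
    using displacement_bounded by metis
  define X where "X = insert S (\<Union>(M, \<beta>)\<in>P. {N. Nt N \<in> set \<beta>})"
  have "finite {N. Nt N \<in> set \<beta>}" for \<beta> :: "('n, 'a letter) symb list"
    using finite_vimageI[of "set \<beta>" Nt] by (simp add: vimage_def inj_def)
  then have "finite X"
    unfolding X_def using finite_prods by auto
  have first_occurrences: "\<exists>A. finite A \<and> inj_on fst A \<and> fst ` A \<subseteq> X \<and> (M, g) \<in> A \<and>
      (\<forall>(N, h)\<in>A. entered N h \<and> (child P)\<^sup>*\<^sup>* (N, h) (M, g) \<and> length h \<le> C * card A)"
    if "entered M g" for M g
    using that
  proof (induction "(M, g)" arbitrary: M g rule: rtranclp_induct)
    case base
    show ?case
      by (intro exI[of _ "{(S, [])}"]) (auto simp: X_def)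
  next
    case (step b)
    obtain M0 g0 where b: "b = (M0, g0)"
      by fastforce
    obtain A where A: "finite A" "inj_on fst A" "fst ` A \<subseteq> X" "(M0, g0) \<in> A"
      "\<And>N h. (N, h) \<in> A \<Longrightarrow>
        entered N h \<and> (child P)\<^sup>*\<^sup>* (N, h) (M0, g0) \<and> length h \<le> C * card A"
      using step(3)[OF b] by blast
    have anc: "(child P)\<^sup>*\<^sup>* (N, h) (M, g)" if "(N, h) \<in> A" for N h
      using rtranclp.rtrancl_into_rtrancl[of "child P" "(N, h)" "(M0, g0)" "(M, g)"]
        A(5)[OF that] step(2) b by simp
    from step(2)[unfolded b] obtain \<alpha> \<beta> x u y where c:
      "(M0, \<alpha> @ Nt M # \<beta>) \<in> P" "yields P \<alpha> x" "yields P [Nt M] u" "yields P \<beta> y"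
      "g = walk g0 x"
      by cases auto
    show ?case
    proof (cases "M \<in> fst ` A")
      case True
      then obtain h where h: "(M, h) \<in> A"
        by auto
      have "g = h"
        using repeated_nonterminal_same_vertex[of M h g u] A(5)[OF h] anc[OF h] c(3) by blast
      have "\<forall>(N, h)\<in>A. entered N h \<and> (child P)\<^sup>*\<^sup>* (N, h) (M, g) \<and> length h \<le> C * card A"
        using A(5) anc by blast
      then show ?thesis
        using A(1-3) h \<open>g = h\<close> by blast
    next
      case False
      have "M \<in> X"
        using c(1) by (force simp: X_def)
      have "entered M g"
        using step(1,2) by simp
      have "length g \<le> length g0 + C"
        using C[OF c(1) _ c(2)] yields_append[OF c(3,4)] step(1) b c(5) by auto
      then have g: "length g \<le> C * Suc (card A)"
        using A(5)[OF A(4)] by simp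
      have card: "card (insert (M, g) A) = Suc (card A)"
        using card_insert_disjoint[OF A(1), of "(M, g)"] False by (metis fst_conv imageI)
      have "entered N h \<and> (child P)\<^sup>*\<^sup>* (N, h) (M, g) \<and> length h \<le> C * card (insert (M, g) A)"
        if "(N, h) \<in> insert (M, g) A" for N h
      proof (cases "(N, h) \<in> A")
        case True
        then show ?thesis
          using A(5)[OF True] anc[OF True] by (simp add: card)
      next
        case False
        then have "N = M" "h = g"
          using that by auto
        then show ?thesis
          using \<open>entered M g\<close> g by (simp add: card)
      qed
      moreover have "inj_on fst (insert (M, g) A)"
        using A(2) False by (auto simp: inj_on_insert)
      moreover have "finite (insert (M, g) A)" "fst ` insert (M, g) A \<subseteq> X"
        using A(1,3) \<open>M \<in> X\<close> by auto
      ultimately show ?thesis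
        by (intro exI[of _ "insert (M, g) A"]) blast
    qed
  qed
  have "length g \<le> C * card X" if "entered M g" for M g
  proof -
    obtain A where A: "inj_on fst A" "fst ` A \<subseteq> X" and "(M, g) \<in> A"
      and all: "\<forall>(N, h)\<in>A.
        entered N h \<and> (child P)\<^sup>*\<^sup>* (N, h) (M, g) \<and> length h \<le> C * card A"
      using first_occurrences[OF \<open>entered M g\<close>] by (elim exE conjE)
    have "length g \<le> C * card A"
      using bspec[OF all \<open>(M, g) \<in> A\<close>] by simp
    moreover have "C * card A \<le> C * card X"
      using card_inj_on_le[OF A \<open>finite X\<close>] by simp
    ultimately show ?thesis
      by (rule order_trans)
  qed
  then show ?thesis
    using that by blast
qed

lemma walk_bounded:
  obtains B where "\<And>w t. yields P [Nt S] w \<Longrightarrow> t \<in> visited [] w \<Longrightarrow> length t \<le> B"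
proof -
  obtain C where C: "\<And>M \<delta> \<gamma> g d z.
    (M, \<delta> @ \<gamma>) \<in> P \<Longrightarrow> entered M g \<Longrightarrow> yields P \<delta> d \<Longrightarrow> yields P \<gamma> z \<Longrightarrow>
      length (walk g d) \<le> length g + C"
    using displacement_bounded by metis
  obtain B where B: "\<And>M g. entered M g \<Longrightarrow> length g \<le> B"
    using entry_bounded by metis
  have position: "length (walk g d) \<le> B + C"
    if "(M, \<delta> @ \<gamma>) \<in> P" "entered M g" "yields P \<delta> d" "yields P \<gamma> z" for M \<delta> \<gamma> g d z
    using C[OF that] B[OF that(2)] by simp
  \<comment> \<open>Descend to the production inside which the given position of the word is reached; \<open>d\<close> is the
    yield of the part \<open>\<delta>\<close> of the current right-hand side that has already been passed.\<close>
  have inside: "length (walk g (d @ a)) \<le> B + C"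
    if "yields P \<gamma> w" "(M, \<delta> @ \<gamma>) \<in> P" "entered M g" "yields P \<delta> d" "w = a @ b"
    for M \<delta> \<gamma> g d w a b
    using that
  proof (induction arbitrary: M \<delta> g d a b rule: yields.induct)
    case Nil
    then show ?case
      using position[OF Nil(1-3) yields.Nil] by simp
  next
    case (Tm \<alpha> w t)
    show ?case
    proof (cases a)
      case Nil
      then show ?thesis
        using position[OF Tm.prems(1-3) yields.Tm[OF Tm.hyps]] by simp
    next
      case (Cons t' a')
      then have "a = t # a'" "w = a' @ b"
        using Tm.prems(4) by auto
      moreover have "yields P (\<delta> @ [Tm t]) (d @ [t])"
        by (intro yields_append Tm.prems yields.intros)
      ultimately show ?thesis
        using Tm.IH[of M "\<delta> @ [Tm t]" g "d @ [t]" a'] Tm.prems by simp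
    qed
  next
    case (Nt N \<beta> u \<alpha> w)
    have u: "yields P [Nt N] u"
      using Nt.hyps by (auto simp: yields_nonterminal)
    from Nt.prems(4) consider a' where "a = u @ a'" "w = a' @ b" | b' where "u = a @ b'"
      by (auto simp: append_eq_append_conv2)
    then show ?case
    proof cases
      case 1
      then show ?thesis
        using Nt.IH(2)[of M "\<delta> @ [Nt N]" g "d @ u" a'] Nt.prems yields_append[OF Nt.prems(3) u]
        by simp
    next
      case 2
      have "child P (M, g) (N, walk g d)"
        using child.intros[OF Nt.prems(1,3) u Nt.hyps(3)] .
      then have "entered N (walk g d)"
        using Nt.prems(2) by simp
      then have "length (walk (walk g d) ([] @ a)) \<le> B + C"
        using Nt.IH(1)[of N "[]" "walk g d" "[]" a b'] Nt.hyps(1) 2 yields.Nil[of P] by simp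
      then show ?thesis
        by (simp add: walk_append)
    qed
  qed
  have "length t \<le> B + C" if w: "yields P [Nt S] w" and t: "t \<in> visited [] w" for w t
  proof -
    obtain \<beta> where "(S, [] @ \<beta>) \<in> P" "yields P \<beta> w"
      using w by (auto simp: yields_nonterminal)
    moreover obtain a b where "w = a @ b" "t = walk [] a"
      using t by (auto simp: visited_def)
    ultimately show ?thesis
      using inside[of \<beta> w S "[]" "[]" "[]" a b] yields.Nil[of P] by simp
  qed
  then show ?thesis
    using that by blast
qed

end


section \<open>Fixed points with arbitrarily large Munn trees\<close>

definition spike :: "nat \<Rightarrow> 'a letter \<Rightarrow> 'a letter list" where
  "spike n b = replicate n b @ inv_word (replicate n b)"

lemma spikes_commute:
  "fim_proj (spike n b) * fim_proj (spike m c) = fim_proj (spike m c) * fim_proj (spike n b)"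
  using fim_cong.commute[of "replicate n b" "replicate m c"]
  by (simp add: spike_def fim_proj_append[symmetric] fim_proj_eq_iff)

lemma (in free_letter_permutation) map_spike: "map \<sigma> (spike n b) = spike n (\<sigma> b)"
  using map_inv_word[of \<sigma>] inv by (simp add: spike_def)

lemma commute_prod_list:
  fixes e :: "'m::monoid_mult"
  assumes "\<And>f. f \<in> set fs \<Longrightarrow> e * f = f * e"
  shows "e * prod_list fs = prod_list fs * e"
  using assms
proof (induction fs)
  case (Cons f fs)
  have "e * (f * prod_list fs) = f * (e * prod_list fs)"
    using Cons.prems[of f] by (simp flip: mult.assoc)
  also have "\<dots> = f * (prod_list fs * e)"
    using Cons by simp
  finally show ?case
    by (simp add: mult.assoc)
qed simp

lemma fim_proj_concat: "fim_proj (concat ws) = prod_list (map fim_proj ws)"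
  by (induction ws) (auto simp: fim_proj_Nil fim_proj_append)

text \<open>The spikes over the orbit of \<open>b\<close>, multiplied in cyclic order: applying \<open>\<sigma>\<close> rotates the
  product, and rotating it back only uses that idempotents commute.\<close>

lemma (in free_letter_permutation) unbounded_fixed_word:
  fixes b :: "'a letter"
  assumes "finite (UNIV :: 'a letter set)"
  shows "\<exists>w. fim_cong (map \<sigma> w) w \<and> (\<exists>t\<in>visited [] w. length t = n)"
proof -
  obtain m where m: "0 < m" "(\<sigma> ^^ m) b = b"
    using funpow_inj_finite[OF inj, of b] finite_subset[OF subset_UNIV assms] by metis
  define f where "f i = spike n ((\<sigma> ^^ i) b)" for i
  define w where "w = concat (map f [0..<m])"
  have split: "[0..<m] = 0 # [1..<m]" "[1..<Suc m] = [1..<m] @ [m]"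
    using m(1) by (auto simp: upt_conv_Cons)
  have shift: "map \<sigma> (f i) = f (Suc i)" for i
    by (simp add: f_def map_spike)
  have "map (map \<sigma> \<circ> f) [0..<m] = map f [1..<Suc m]"
    by (simp add: map_Suc_upt[symmetric] shift del: upt_Suc)
  then have "map \<sigma> w = concat (map f [1..<Suc m])"
    by (simp add: w_def map_concat)
  also have "\<dots> = concat (map f [1..<m]) @ f 0"
    using m(2) by (simp only: split) (simp add: f_def)
  finally have "fim_proj (map \<sigma> w) = prod_list (map (fim_proj \<circ> f) [1..<m]) * fim_proj (f 0)"
    by (simp add: fim_proj_append fim_proj_concat)
  also have "\<dots> = fim_proj (f 0) * prod_list (map (fim_proj \<circ> f) [1..<m])"
    by (rule commute_prod_list[symmetric]) (auto simp: f_def spikes_commute)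
  also have "\<dots> = fim_proj w"
    by (simp add: w_def split fim_proj_append fim_proj_concat)
  finally have "fim_cong (map \<sigma> w) w"
    by (simp add: fim_proj_eq_iff)
  moreover have "reduced (replicate n b)"
    by (induction n) (auto simp: reduced_Cons_iff hd_replicate)
  then have "walk [] (replicate n b) = replicate n b"
    using walk_reduced[of "[]" "replicate n b"] by simp
  then have "replicate n b \<in> visited [] w"
    unfolding visited_def w_def
    by (intro CollectI exI[of _ "replicate n b"]
        exI[of _ "inv_word (replicate n b) @ concat (map f [1..<m])"])
      (simp add: split f_def spike_def)
  ultimately show ?thesis
    by (metis length_replicate)
qed

lemma finite_letters: "finite (UNIV :: 'a::finite letter set)"
proof -
  have "x \<in> range Pos \<union> range Neg" for x :: "'a letter"
    by (cases x) auto
  then have "(UNIV :: 'a letter set) \<subseteq> range Pos \<union> range Neg"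
    by blast
  then show ?thesis
    by (rule finite_subset) simp
qed

theorem corollary3p11:
  fixes \<phi> :: "'a::finite fim \<Rightarrow> 'a fim"
  assumes "fim_endomorphism \<phi>"
    and "bij_betw \<phi> fim_letters fim_letters"
    and "\<forall>x\<in>fim_letters. \<phi> x \<noteq> x"
  shows "\<not> fim_context_free (Fix \<phi>)"
proof
  assume "fim_context_free (Fix \<phi>)"
  then obtain P :: "(nat, 'a letter) prods" and S where
    P: "finite P" "Fix \<phi> = fim_proj ` {w. yields P [Nt S] w}"
    by (auto simp: fim_context_free_def context_free_def generated_language_yields)
  obtain \<sigma> where \<sigma>: "inj \<sigma>" "\<And>x. \<sigma> (inv_letter x) = inv_letter (\<sigma> x)" "\<And>x. \<sigma> x \<noteq> x"
    and \<phi>: "\<And>w. \<phi> (fim_proj w) = fim_proj (map \<sigma> w)"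
    using letter_permutation[OF assms] by metis
  have Fix_iff: "fim_proj w \<in> Fix \<phi> \<longleftrightarrow> fim_cong (map \<sigma> w) w" for w
    by (simp add: Fix_def \<phi> fim_proj_eq_iff)
  interpret free_letter_permutation \<sigma>
    using \<sigma> by unfold_locales
  interpret fixed_word_grammar \<sigma> P S
    using P by unfold_locales (auto simp flip: Fix_iff)
  obtain B where B: "\<And>w t. yields P [Nt S] w \<Longrightarrow> t \<in> visited [] w \<Longrightarrow> length t \<le> B"
    using walk_bounded by metis
  obtain v t where v: "fim_cong (map \<sigma> v) v" "t \<in> visited [] v" "length t = Suc B"
    using unbounded_fixed_word[OF finite_letters, of "Suc B"] by blast
  have "fim_proj v \<in> fim_proj ` {w. yields P [Nt S] w}"
    using v(1) P(2) Fix_iff by simp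
  then obtain w where "yields P [Nt S] w" "fim_proj w = fim_proj v"
    by force
  then show False
    using B[of w t] v fim_cong_visited[of w v "[]"] by (simp add: fim_proj_eq_iff)
qed

end
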